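(* Let $n\ge 2$, let $\rho$ be a real-analytic function on an open set $\widetilde\Omega\subset\mathbb{R}^{2n}$, let $\mathcal{A}=(\alpha_{j,i})_{1\le j,i\le 2n}$ be a real $2n\times 2n$ matrix whose entries are real-analytic functions on $\widetilde\Omega$, and consider a point of $\widetilde\Omega$ at which $D\neq 0$. Let $q\ge 1$ be an integer. At this point, with $D$, $\beta$, $\mathfrak{D}_0$, the tableau $A=A^{(0)}$ and its prolongations $A^{(q)}$ as defined in the context, if $$\mathfrak{D}_0\beta^{q-1}\in \mathrm{Span}\big(\mathfrak{D}_0\beta^{q-2},\ \mathfrak{D}_0\beta^{q-3},\ \dots,\ \mathfrak{D}_0\beta,\ \mathfrak{D}_0\big),$$ then $A^{(q-1)}$ is involutive.
   Context: The problem behind these objects is the PDE system $\rho(f(x))=0$, $\partial f/\partial x_2=\mathcal{A}(f)\,\partial f/\partial x_1$ for maps $f$ from an open set of $\mathbb{R}^2$ to $\widetilde\Omega$. All quantities below are evaluated at the given point. Write $\rho_j=\partial\rho/\partial y_j$, let $\alpha^{(2)}_{j,i}$ be the entries of $\mathcal{A}^2$, and for $1\le i\le 2n$ put $$\mu_i=\sum_{j=1}^{2n}\rho_j\alpha_{j,i},\qquad \mu^{(2)}_i=\sum_{j=1}^{2n}\rho_j\alpha^{(2)}_{j,i}.$$ Put $D=\rho_1\mu_2-\rho_2\mu_1$, assumed nonzero. For $3\le i\le 2n$ and $1\le j\le 2n$ put $$\gamma^1_i=-\tfrac1D(\rho_i\mu_2-\rho_2\mu_i),\qquad \gamma^2_i=-\tfrac1D(\rho_1\mu_i-\rho_i\mu_1),\qquad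 \beta_{j,i}=\alpha_{j,1}\gamma^1_i+\alpha_{j,2}\gamma^2_i+\alpha_{j,i}.$$ Let $\beta=(\beta_{j,i})_{3\le j,i\le 2n}$, a $(2n-2)\times(2n-2)$ matrix, and let $\mathfrak{D}_0=(\mathfrak{D}_{0,3},\dots,\mathfrak{D}_{0,2n})$ be the row vector with $$\mathfrak{D}_{0,i}=-\frac1{D^2}\Big\{\rho_1\big[\mu_i\mu^{(2)}_2-\mu_2\mu^{(2)}_i\big]+\rho_2\big[\mu_1\mu^{(2)}_i-\mu_i\mu^{(2)}_1\big]+\rho_i\big[\mu_2\mu^{(2)}_1-\mu_1\mu^{(2)}_2\big]\Big\}.$$ Tableau: let $e_1,\dots,e_{2n}$ be the standard basis of $\mathbb{R}^{2n}$ and $x_1,x_2$ the coordinates on $\mathbb{R}^2$. For $3\le j\le 2n$ let $$U_j=-\Big[\gamma^1_j\,e_1\otimes x_1+\gamma^2_j\,e_2\otimes x_1+e_j\otimes x_1+\sum_{i=1}^{2n}\beta_{i,j}\,e_i\otimes x_2\Big],$$ and let $A=A^{(0)}$ be the span of $U_3,\dots,U_{2n}$ (a space of $\mathbb{R}^{2n}$-valued linear forms in $x_1,x_2$). For $q\ge 1$, $A^{(q)}$ is the space of $\mathbb{R}^{2n}$-valued homogeneous polynomials $P$ of degree $q+1$ in $x_1,x_2$ all of whose partial derivatives of order $q$ lie in $A$. Put $A^{(q)}_1=\{P\in A^{(q)}:\partial P/\partial x_1=0\}$. $A^{(q)}$ is called involutive if $\dim A^{(q+1)}=\dim A^{(q)}+\dim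 A^{(q)}_1$. For $q=1$ the span of the empty list of vectors is $\{0\}$. *)

theory Defs
  imports
    "HOL-Analysis.Analysis"
    "HOL-Computational_Algebra.Polynomial"
    "HOL-Library.Numeral_Type"
begin

text \<open>
  The space \<open>\<real>\<^sup>2\<^sup>n\<close> is \<^typ>\<open>real^(2 + 'm)\<close> with \<open>CARD(2 + 'm) = 2 * n\<close>: the indices \<open>1\<close> and \<open>2\<close>
  are \<^term>\<open>Inl 1\<close> and \<^term>\<open>Inl 2\<close>, the indices \<open>3, \<dots>, 2n\<close> are the \<open>Inr i\<close> with \<open>i :: 'm\<close>.
  Thus \<open>(2n-2) \<times> (2n-2)\<close> matrices and row vectors of length \<open>2n-2\<close> indexed by \<open>3, \<dots>, 2n\<close> are
  of types \<^typ>\<open>real^'m^'m\<close> and \<^typ>\<open>real^'m\<close>.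
\<close>

subsection \<open>Real-analytic functions and partial derivatives\<close>

text \<open>A function \<open>\<nu> :: 'k \<Rightarrow> nat\<close> is a multi-index.\<close>

definition real_analytic_on :: "(real^'k::finite \<Rightarrow> real) \<Rightarrow> (real^'k) set \<Rightarrow> bool" where
  "real_analytic_on f S \<longleftrightarrow>
     (\<forall>a\<in>S. \<exists>e>0. \<exists>c :: ('k \<Rightarrow> nat) \<Rightarrow> real. \<forall>y \<in> ball a e \<inter> S.
        ((\<lambda>\<nu>. c \<nu> * (\<Prod>k\<in>UNIV. (y $ k - a $ k) ^ \<nu> k)) has_sum f y) UNIV)"

definition partial_deriv :: "(real^'k::finite \<Rightarrow> real) \<Rightarrow> 'k \<Rightarrow> real^'k \<Rightarrow> real" where
  "partial_deriv f k y = deriv (\<lambda>t. f (y + t *\<^sub>R axis k 1)) 0"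

definition gradient :: "(real^'k::finite \<Rightarrow> real) \<Rightarrow> real^'k \<Rightarrow> real^'k" where
  "gradient f y = (\<chi> k. partial_deriv f k y)"

subsection \<open>The quantities at a point\<close>

text \<open>
  Here \<open>r\<close> stands for the row vector \<open>(\<rho>\<^sub>1, \<dots>, \<rho>\<^sub>2\<^sub>n)\<close> of derivatives of \<open>\<rho>\<close>, and \<open>M\<close> for the
  matrix \<open>\<A>\<close>, both at the given point; \<open>M $ j $ i\<close> is \<open>\<alpha>\<^sub>j\<^sub>,\<^sub>i\<close>.
\<close>

definition mu :: "real^(2 + 'm::finite) \<Rightarrow> real^(2 + 'm)^(2 + 'm) \<Rightarrow> real^(2 + 'm)" where
  "mu r M = (\<chi> i. \<Sum>j\<in>UNIV. r $ j * M $ j $ i)"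

definition mu2 :: "real^(2 + 'm::finite) \<Rightarrow> real^(2 + 'm)^(2 + 'm) \<Rightarrow> real^(2 + 'm)" where
  "mu2 r M = (\<chi> i. \<Sum>j\<in>UNIV. r $ j * (M ** M) $ j $ i)"

definition DD :: "real^(2 + 'm::finite) \<Rightarrow> real^(2 + 'm)^(2 + 'm) \<Rightarrow> real" where
  "DD r M = r $ Inl 1 * mu r M $ Inl 2 - r $ Inl 2 * mu r M $ Inl 1"

definition gamma1 :: "real^(2 + 'm::finite) \<Rightarrow> real^(2 + 'm)^(2 + 'm) \<Rightarrow> 'm \<Rightarrow> real" where
  "gamma1 r M i =
     - (1 / DD r M) * (r $ Inr i * mu r M $ Inl 2 - r $ Inl 2 * mu r M $ Inr i)"

definition gamma2 :: "real^(2 + 'm::finite) \<Rightarrow> real^(2 + 'm)^(2 + 'm) \<Rightarrow> 'm \<Rightarrow> real" where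
  "gamma2 r M i =
     - (1 / DD r M) * (r $ Inl 1 * mu r M $ Inr i - r $ Inr i * mu r M $ Inl 1)"

definition beta_entry ::
    "real^(2 + 'm::finite) \<Rightarrow> real^(2 + 'm)^(2 + 'm) \<Rightarrow> 2 + 'm \<Rightarrow> 'm \<Rightarrow> real" where
  "beta_entry r M j i =
     M $ j $ Inl 1 * gamma1 r M i + M $ j $ Inl 2 * gamma2 r M i + M $ j $ Inr i"

definition beta :: "real^(2 + 'm::finite) \<Rightarrow> real^(2 + 'm)^(2 + 'm) \<Rightarrow> real^'m^'m" where
  "beta r M = (\<chi> j i. beta_entry r M (Inr j) i)"

definition D0 :: "real^(2 + 'm::finite) \<Rightarrow> real^(2 + 'm)^(2 + 'm) \<Rightarrow> real^'m" where
  "D0 r M = (\<chi> i. - (1 / (DD r M)\<^sup>2) *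
     (r $ Inl 1 * (mu r M $ Inr i * mu2 r M $ Inl 2 - mu r M $ Inl 2 * mu2 r M $ Inr i)
    + r $ Inl 2 * (mu r M $ Inl 1 * mu2 r M $ Inr i - mu r M $ Inr i * mu2 r M $ Inl 1)
    + r $ Inr i * (mu r M $ Inl 2 * mu2 r M $ Inl 1 - mu r M $ Inl 1 * mu2 r M $ Inl 2)))"

text \<open>\<open>*\<close> and \<open>^\<close> on \<^typ>\<open>real^'m^'m\<close> are componentwise, hence the explicit matrix power.\<close>

definition mat_power :: "real^'m^'m \<Rightarrow> nat \<Rightarrow> real^'m^'m::finite" where
  "mat_power B k = ((\<lambda>X. X ** B) ^^ k) (mat 1)"

subsection \<open>Vector-valued polynomials in two variables\<close>

text \<open>
  A polynomial in \<open>x\<^sub>1, x\<^sub>2\<close> is an element of \<open>\<real>[x\<^sub>1][x\<^sub>2]\<close>: the inner variable is \<open>x\<^sub>1\<close>, the outer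
  one \<open>x\<^sub>2\<close>, so that \<open>coeff (coeff p b) a\<close> is the coefficient of \<open>x\<^sub>1\<^sup>a x\<^sub>2\<^sup>b\<close>.
\<close>

type_synonym 'k vpoly = "real poly poly ^ 'k"

definition X1 :: "real poly poly" where "X1 = monom (monom 1 1) 0"

definition X2 :: "real poly poly" where "X2 = monom (monom 1 0) 1"

definition const :: "real \<Rightarrow> real poly poly" where "const c = [:[:c:]:]"

definition vscale :: "real \<Rightarrow> 'k vpoly \<Rightarrow> 'k::finite vpoly" where
  "vscale c P = const c *s P"

global_interpretation vpoly: vector_space "vscale :: real \<Rightarrow> 'k::finite vpoly \<Rightarrow> 'k vpoly"
  by unfold_locales
    (simp_all add: vscale_def const_def vec_eq_iff vector_scalar_mult_def algebra_simps pCons_one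
      flip: smult_add_left)

definition tensor :: "'k \<Rightarrow> real poly poly \<Rightarrow> 'k::finite vpoly"  (infixr \<open>\<otimes>\<^sub>v\<close> 75) where
  "k \<otimes>\<^sub>v p = axis k p"

definition d1 :: "'k vpoly \<Rightarrow> 'k::finite vpoly" where
  "d1 P = (\<chi> k. map_poly pderiv (P $ k))"

definition d2 :: "'k vpoly \<Rightarrow> 'k::finite vpoly" where
  "d2 P = (\<chi> k. pderiv (P $ k))"

definition homogeneous :: "nat \<Rightarrow> 'k::finite vpoly \<Rightarrow> bool" where
  "homogeneous d P \<longleftrightarrow> (\<forall>k a b. coeff (coeff (P $ k) b) a \<noteq> 0 \<longrightarrow> a + b = d)"

subsection \<open>The tableau, its prolongations and involutivity\<close>

definition U :: "real^(2 + 'm::finite) \<Rightarrow> real^(2 + 'm)^(2 + 'm) \<Rightarrow> 'm \<Rightarrow> (2 + 'm) vpoly" where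
  "U r M j =
     - (vscale (gamma1 r M j) (Inl 1 \<otimes>\<^sub>v X1) + vscale (gamma2 r M j) (Inl 2 \<otimes>\<^sub>v X1)
        + Inr j \<otimes>\<^sub>v X1 + (\<Sum>i\<in>UNIV. vscale (beta_entry r M i j) (i \<otimes>\<^sub>v X2)))"

definition tableau ::
    "real^(2 + 'm::finite) \<Rightarrow> real^(2 + 'm)^(2 + 'm) \<Rightarrow> (2 + 'm) vpoly set" where
  "tableau r M = vpoly.span (range (U r M))"

definition prolongation :: "'k::finite vpoly set \<Rightarrow> nat \<Rightarrow> 'k vpoly set" where
  "prolongation A q =
     (if q = 0 then A
      else {P. homogeneous (q + 1) P \<and> (\<forall>a b. a + b = q \<longrightarrow> (d1 ^^ a) ((d2 ^^ b) P) \<in> A)})"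

definition prolongation1 :: "'k::finite vpoly set \<Rightarrow> nat \<Rightarrow> 'k vpoly set" where
  "prolongation1 A q = {P \<in> prolongation A q. d1 P = 0}"

definition involutive_prolongation :: "'k::finite vpoly set \<Rightarrow> nat \<Rightarrow> bool" where
  "involutive_prolongation A q \<longleftrightarrow>
     vpoly.dim (prolongation A (q + 1)) = vpoly.dim (prolongation A q) + vpoly.dim (prolongation1 A q)"

end

theory Submission
  imports Defs
begin

text \<open>
  Write \<open>r\<close> for the covector \<open>(\<rho>\<^sub>1, \<dots>, \<rho>\<^sub>2\<^sub>n)\<close> and \<open>M\<close> for the matrix \<open>\<A>\<close> at the point, so that
  \<open>\<mu> = r M\<close> and \<open>\<mu>\<^sup>(\<^sup>2\<^sup>) = r M\<^sup>2\<close>. The functions \<open>\<gamma>\<^sup>1, \<gamma>\<^sup>2\<close> are Cramer's rule for the system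
  \<open>r \<bullet> w = 0\<close>, \<open>r \<bullet> M w = 0\<close> with the last \<open>2n - 2\<close> coordinates of \<open>w\<close> prescribed; its determinant
  is \<open>D\<close>. Hence the tableau consists of the linear forms \<open>w x\<^sub>1 + M w x\<^sub>2\<close> with \<open>r \<bullet> w = r \<bullet> M w = 0\<close>:
  it is the space of linear solutions \<open>P\<close> of the system with constant coefficients
  \<open>r \<bullet> P = 0\<close>, \<open>\<partial>\<^sub>2P = M \<partial>\<^sub>1P\<close>.

  The \<open>q\<close>-th prolongation is then the space of homogeneous solutions of degree \<open>q + 1\<close>. The
  equation \<open>\<partial>\<^sub>2P = M \<partial>\<^sub>1P\<close> determines \<open>P = (x\<^sub>1 + x\<^sub>2 M)\<^sup>q\<^sup>+\<^sup>1 w / (q + 1)!\<close> by the vector \<open>w\<close>, and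
  \<open>r \<bullet> P = 0\<close> says that \<open>w\<close> is annihilated by \<open>r, r M, \<dots>, r M\<^sup>q\<^sup>+\<^sup>1\<close>
  (\<open>prolongation_tableau_eq\<close>). A solution that does not depend on \<open>x\<^sub>1\<close> has \<open>w = 0\<close>, so
  \<open>A\<^sup>(\<^sup>q\<^sup>)\<^sub>1 = 0\<close> and involutivity of \<open>A\<^sup>(\<^sup>q\<^sup>)\<close> means that imposing the further condition
  \<open>r M\<^sup>q\<^sup>+\<^sup>2 w = 0\<close> does not lower the dimension (\<open>involutive_tableau_iff\<close>).

  This is where the row vector \<open>\<delta> = \<D>\<^sub>0\<close> and \<open>\<beta>\<close> enter. Parametrize \<open>ker r \<inter> ker r M\<close> by the last
  \<open>2n - 2\<close> coordinates \<open>v\<close>. In this chart \<open>\<delta>\<close> is \<open>r M\<^sup>2 / D\<close>, and \<open>\<beta>\<close> is \<open>M\<close> as long as \<open>M\<close> does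
  not lead out of the kernel. So for \<open>w\<close> annihilated by \<open>r, \<dots>, r M\<^sup>k\<^sup>+\<^sup>1\<close> the number \<open>\<delta> \<beta>\<^sup>k v\<close> is
  \<open>r M\<^sup>k\<^sup>+\<^sup>2 w / D\<close> (\<open>inner_D0_beta_power\<close>). If \<open>\<delta> \<beta>\<^sup>q\<close> is a combination of the
  \<open>\<delta> \<beta>\<^sup>k\<close> with \<open>k < q\<close>, and \<open>w\<close> is annihilated by \<open>r, \<dots>, r M\<^sup>q\<^sup>+\<^sup>1\<close>, then these vanish on
  \<open>v\<close>, hence so does \<open>\<delta> \<beta>\<^sup>q\<close>, and \<open>r M\<^sup>q\<^sup>+\<^sup>2 w = 0\<close> holds automatically
  (\<open>krylov_kernel_stable\<close>).
\<close>

section \<open>Coefficients of vector-valued polynomials\<close>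

definition vcoeff :: "'k::finite vpoly \<Rightarrow> nat \<Rightarrow> nat \<Rightarrow> real^'k" where
  "vcoeff P a b = (\<chi> k. coeff (coeff (P $ k) b) a)"

lemma vpoly_eqI: "(\<And>a b. vcoeff P a b = vcoeff Q a b) \<Longrightarrow> P = Q"
  by (simp add: vcoeff_def vec_eq_iff poly_eq_iff)

lemma vcoeff_add [simp]: "vcoeff (P + Q) a b = vcoeff P a b + vcoeff Q a b"
  and vcoeff_diff [simp]: "vcoeff (P - Q) a b = vcoeff P a b - vcoeff Q a b"
  and vcoeff_minus [simp]: "vcoeff (- P) a b = - vcoeff P a b"
  and vcoeff_0 [simp]: "vcoeff 0 a b = 0"
  and vcoeff_vscale [simp]: "vcoeff (vscale c P) a b = c *\<^sub>R vcoeff P a b"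
  by (simp_all add: vcoeff_def vec_eq_iff vscale_def const_def vector_scalar_mult_def)

lemma vcoeff_sum [simp]: "vcoeff (\<Sum>i\<in>I. P i) a b = (\<Sum>i\<in>I. vcoeff (P i) a b)"
  by (induction I rule: infinite_finite_induct) auto

lemma vcoeff_tensor_X1: "vcoeff (k \<otimes>\<^sub>v X1) a b = (if a = 1 \<and> b = 0 then axis k 1 else 0)"
  and vcoeff_tensor_X2: "vcoeff (k \<otimes>\<^sub>v X2) a b = (if a = 0 \<and> b = 1 then axis k 1 else 0)"
  by (auto simp: vcoeff_def vec_eq_iff tensor_def X1_def X2_def axis_def)

lemma homogeneous_iff: "homogeneous d P \<longleftrightarrow> (\<forall>a b. vcoeff P a b \<noteq> 0 \<longrightarrow> a + b = d)"
  by (auto simp: homogeneous_def vcoeff_def vec_eq_iff)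

lemma vcoeff_d1_pow:
  fixes P :: "'k::finite vpoly"
  shows
  "vcoeff ((d1 ^^ m) P) a b = pochhammer (real (Suc a)) m *\<^sub>R vcoeff P (a + m) b"
proof -
  have "vcoeff (d1 Q) a b = real (Suc a) *\<^sub>R vcoeff Q (Suc a) b" for Q :: "'k vpoly" and a
    by (simp add: vcoeff_def d1_def vec_eq_iff coeff_map_poly coeff_pderiv)
  then show ?thesis
    by (induction m arbitrary: a) (simp_all add: pochhammer_rec add_ac)
qed

lemma vcoeff_d2_pow:
  fixes P :: "'k::finite vpoly"
  shows
  "vcoeff ((d2 ^^ m) P) a b = pochhammer (real (Suc b)) m *\<^sub>R vcoeff P a (b + m)"
proof -
  have of_nat_mult_coeff: "coeff (of_nat k * c) a = of_nat k * coeff c a" for k and c :: "real poly"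
    by (induction k) (simp_all add: algebra_simps)
  have "vcoeff (d2 Q) a b = real (Suc b) *\<^sub>R vcoeff Q a (Suc b)" for Q :: "'k vpoly" and b
    using of_nat_mult_coeff[of "Suc b"]
    by (simp add: vcoeff_def d2_def vec_eq_iff coeff_pderiv del: of_nat_Suc)
  then show ?thesis
    by (induction m arbitrary: b) (simp_all add: pochhammer_rec add_ac)
qed

lemma vcoeff_derivatives:
  "vcoeff ((d1 ^^ m) ((d2 ^^ n) P)) a b =
     (pochhammer (real (Suc a)) m * pochhammer (real (Suc b)) n) *\<^sub>R vcoeff P (a + m) (b + n)"
  by (simp add: vcoeff_d1_pow vcoeff_d2_pow)

section \<open>Homogeneous solutions of the equation with constant coefficients\<close>

text \<open>
  This is \<open>(x\<^sub>1 + x\<^sub>2 M)\<^sup>d w / d!\<close>, the homogeneous solution of degree \<open>d\<close> of \<open>\<partial>\<^sub>2P = M \<partial>\<^sub>1P\<close> with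
  \<open>\<partial>\<^sub>1\<^sup>d P = w\<close>.
\<close>

definition solution :: "real^'k^'k \<Rightarrow> nat \<Rightarrow> real^'k \<Rightarrow> 'k::finite vpoly" where
  "solution M d w = (\<chi> k. \<Sum>b\<le>d.
     monom (monom ((((*v) M ^^ b) w) $ k / (fact (d - b) * fact b)) (d - b)) b)"

lemma vcoeff_solution:
  "vcoeff (solution M d w) a b =
     (if a + b = d then (1 / (fact a * fact b)) *\<^sub>R (((*v) M ^^ b) w) else 0)"
proof -
  have "coeff (coeff (solution M d w $ k) b) a =
      (if a + b = d then (((*v) M ^^ b) w) $ k / (fact a * fact b) else 0)" for k
  proof -
    have "coeff (coeff (solution M d w $ k) b) a = (\<Sum>j\<le>d. if j = b then
        coeff (monom ((((*v) M ^^ b) w) $ k / (fact (d - b) * fact b)) (d - b)) a else 0)"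
      by (auto simp: solution_def coeff_sum intro!: sum.cong)
    also have "\<dots> = (if a + b = d then (((*v) M ^^ b) w) $ k / (fact a * fact b) else 0)"
      by (auto simp: sum.delta)
    finally show ?thesis .
  qed
  then show ?thesis
    by (simp add: vcoeff_def vec_eq_iff)
qed

lemma linear_mult_pow: "linear (((*v) M ^^ b) :: real^'k \<Rightarrow> real^'k::finite)"
proof (induction b)
  case (Suc b)
  then show ?case
    using linear_compose[OF Suc matrix_vector_mul_linear[of M]] by (simp add: o_def)
qed (simp add: linear_id[unfolded id_def] id_def)

lemma linear_solution: "Vector_Spaces.linear scaleR vscale (solution M d)"
proof -
  have "solution M d (v + w) = solution M d v + solution M d w"
    and "solution M d (c *\<^sub>R v) = vscale c (solution M d v)" for v w c
    by (rule vpoly_eqI; simp add: vcoeff_solution linear_add[OF linear_mult_pow]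
        linear_cmul[OF linear_mult_pow] scaleR_add_right)+
  then show ?thesis
    by unfold_locales (auto simp: scaleR_add_left scaleR_add_right)
qed

lemma inj_solution: "inj (solution M d)"
proof (rule injI)
  fix v w assume "solution M d v = solution M d w"
  then have "vcoeff (solution M d v) d 0 = vcoeff (solution M d w) d 0" by simp
  then show "v = w" by (simp add: vcoeff_solution)
qed

text \<open>
  The polynomials form a space of infinite dimension, so the comparison is made by transporting a
  basis of the span along the injective linear map \<open>solution M d\<close>.
\<close>

lemma dim_image_solution:
  fixes S :: "(real^'k::finite) set"
  shows "vpoly.dim (solution M d ` S) = dim S"
proof -
  interpret vector_space_pair "scaleR :: real \<Rightarrow> real^'k \<Rightarrow> _" "vscale :: real \<Rightarrow> 'k vpoly \<Rightarrow> _"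
    by unfold_locales (auto simp: scaleR_add_left scaleR_add_right)
  obtain B where B: "B \<subseteq> S" "independent B" "S \<subseteq> span B" "card B = dim S"
    using basis_exists by blast
  have inj: "inj_on (solution M d) T" for T
    using inj_solution inj_on_subset by blast
  have "span B = span S"
    using B by (metis span_eq span_mono span_superset subset_trans)
  then have "vpoly.span (solution M d ` B) = vpoly.span (solution M d ` S)"
    by (simp add: linear_span_image[OF linear_solution] flip: span_raw_def)
  moreover have "vpoly.independent (solution M d ` B)"
    using linear_independent_injective_image[OF linear_solution _ inj] B(2) by (simp add: dependent_raw_def)
  ultimately have "vpoly.dim (solution M d ` S) = card (solution M d ` B)"
    by (rule vpoly.dim_eq_card)
  then show ?thesis
    using B(4) card_image[OF inj] by metis
qed

section \<open>The chart of the common kernel of the covectors r and r M\<close>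

text \<open>
  The matrix with columns \<open>(\<gamma>\<^sup>1\<^sub>i, \<gamma>\<^sup>2\<^sub>i, e\<^sub>i)\<close>: the inverse of the chart that keeps the coordinates
  \<open>3, \<dots>, 2n\<close>.
\<close>

definition lift :: "real^(2 + 'm::finite) \<Rightarrow> real^(2 + 'm)^(2 + 'm) \<Rightarrow> real^'m \<Rightarrow> real^(2 + 'm)" where
  "lift r M v = (\<chi> s. case s of
       Inl t \<Rightarrow> if t = 1 then \<Sum>i\<in>UNIV. gamma1 r M i * v $ i else \<Sum>i\<in>UNIV. gamma2 r M i * v $ i
     | Inr i \<Rightarrow> v $ i)"

lemma sum_UNIV_2_plus:
  "(\<Sum>s\<in>(UNIV :: (2 + 'm::finite) set). f s) = f (Inl 1) + f (Inl 2) + (\<Sum>i\<in>UNIV. f (Inr i))"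
  by (simp add: UNIV_Plus_UNIV[symmetric] sum.Plus sum_2 del: UNIV_Plus_UNIV)

lemma lift_nth [simp]:
  "lift r M v $ Inl 1 = (\<Sum>i\<in>UNIV. gamma1 r M i * v $ i)"
  "lift r M v $ Inl 2 = (\<Sum>i\<in>UNIV. gamma2 r M i * v $ i)"
  "lift r M v $ Inr i = v $ i"
  by (simp_all add: lift_def)

lemma inner_lift:
  "x \<bullet> lift r M v =
     (\<Sum>i\<in>UNIV. (x $ Inl 1 * gamma1 r M i + x $ Inl 2 * gamma2 r M i + x $ Inr i) * v $ i)"
  by (simp add: inner_vec_def sum_UNIV_2_plus sum_distrib_left sum.distrib algebra_simps)

lemma mu_inner: "mu r M \<bullet> w = r \<bullet> (M *v w)"
proof -
  have "mu r M = r v* M"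
    by (simp add: mu_def vector_matrix_mult_def vec_eq_iff mult.commute)
  then show ?thesis
    by (simp add: dot_lmul_matrix)
qed

lemma mu2_inner: "mu2 r M \<bullet> w = r \<bullet> (M *v (M *v w))"
proof -
  have "mu2 r M = r v* (M ** M)"
    by (simp add: mu2_def vector_matrix_mult_def vec_eq_iff mult.commute)
  then show ?thesis
    by (simp add: dot_lmul_matrix matrix_vector_mul_assoc)
qed

lemma mult_lift_nth: "(M *v lift r M v) $ s = (\<Sum>i\<in>UNIV. beta_entry r M s i * v $ i)"
proof -
  have "(M *v lift r M v) $ s = M $ s \<bullet> lift r M v"
    by (simp add: matrix_vector_mult_def inner_vec_def)
  then show ?thesis
    by (simp add: inner_lift beta_entry_def)
qed

text \<open>Cramer's rule: the \<open>\<gamma>\<close>s were chosen to solve these two equations.\<close>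

lemma lift_in_kernel:
  assumes "DD r M \<noteq> 0"
  shows "r \<bullet> lift r M v = 0" "r \<bullet> (M *v lift r M v) = 0"
proof -
  have "r $ Inl 1 * gamma1 r M i + r $ Inl 2 * gamma2 r M i + r $ Inr i = 0"
    "mu r M $ Inl 1 * gamma1 r M i + mu r M $ Inl 2 * gamma2 r M i + mu r M $ Inr i = 0" for i
    using assms unfolding gamma1_def gamma2_def 
    by (simp_all add: field_simps) (simp_all add: DD_def algebra_simps)
  then show "r \<bullet> lift r M v = 0" "r \<bullet> (M *v lift r M v) = 0"
    by (simp_all add: inner_lift flip: mu_inner)
qed

text \<open>
  The difference of the two sides lies in the kernel and has only its first two coordinates
  nonzero; there the two equations have determinant \<open>D\<close>.
\<close>

lemma kernel_imp_lift:
  assumes D: "DD r M \<noteq> 0" and "r \<bullet> w = 0" "r \<bullet> (M *v w) = 0"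
  shows "w = lift r M (\<chi> i. w $ Inr i)"
proof -
  define u where "u = w - lift r M (\<chi> i. w $ Inr i)"
  have "r \<bullet> u = 0" "mu r M \<bullet> u = 0"
    using assms lift_in_kernel[OF D]
    by (simp_all add: u_def mu_inner inner_diff_right matrix_vector_mult_diff_distrib)
  moreover have Inr: "u $ Inr i = 0" for i
    by (simp add: u_def)
  ultimately have *: "r $ Inl 1 * u $ Inl 1 + r $ Inl 2 * u $ Inl 2 = 0"
    "mu r M $ Inl 1 * u $ Inl 1 + mu r M $ Inl 2 * u $ Inl 2 = 0"
    by (simp_all add: inner_vec_def sum_UNIV_2_plus)
  have "DD r M * u $ Inl 1 = 0" "DD r M * u $ Inl 2 = 0"
    using * unfolding DD_def by algebra+
  then have "u $ s = 0" for s
    using D Inr exhaust_2 by (cases s) (metis mult_eq_0_iff)+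
  then have "u = 0"
    by (simp add: vec_eq_iff)
  then show ?thesis
    by (simp add: u_def)
qed

text \<open>
  The bracket that defines \<open>\<D>\<^sub>0\<^sub>,\<^sub>i\<close> is, up to sign, the determinant with rows \<open>r\<close>, \<open>r M\<close>, \<open>r M\<^sup>2\<close> and
  columns \<open>1, 2, i\<close>. Subtracting from the last column the combination of the first two that
  cancels its entries in the rows \<open>r\<close> and \<open>r M\<close> leaves \<open>D\<close> times the value of \<open>r M\<^sup>2\<close> on the
  \<open>i\<close>-th column of the lift.
\<close>

lemma D0_inner:
  assumes "DD r M \<noteq> 0"
  shows "D0 r M \<bullet> v = (r \<bullet> (M *v (M *v lift r M v))) / DD r M"
proof -
  have "D0 r M $ i = (mu2 r M $ Inl 1 * gamma1 r M i + mu2 r M $ Inl 2 * gamma2 r M i + mu2 r M $ Inr i) / DD r M" for i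
    using assms unfolding gamma1_def gamma2_def D0_def
    by (simp add: field_simps power2_eq_square) (simp add: DD_def algebra_simps)
  then show ?thesis
    by (simp add: inner_lift inner_vec_def[of "D0 r M"] sum_divide_distrib flip: mu2_inner)
qed

section \<open>The tableau and its prolongations\<close>

lemma vcoeff_U:
  "vcoeff (U r M j) a b =
     - (if a = 1 \<and> b = 0 then lift r M (axis j 1)
        else if a = 0 \<and> b = 1 then M *v lift r M (axis j 1) else 0)"
proof -
  have "lift r M (axis j 1) = gamma1 r M j *\<^sub>R axis (Inl 1) 1 + gamma2 r M j *\<^sub>R axis (Inl 2) 1 + axis (Inr j) 1"
  proof (subst vec_eq_iff, rule allI)
    fix s show "lift r M (axis j 1) $ s = (gamma1 r M j *\<^sub>R axis (Inl 1) 1 + gamma2 r M j *\<^sub>R axis (Inl 2) 1 + axis (Inr j) 1) $ s"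
    proof (cases s)
      case (Inl t)
      then show ?thesis using exhaust_2[of t] by (auto simp: axis_def if_distrib cong: if_cong)
    qed (auto simp: axis_def)
  qed
  moreover have "M *v lift r M (axis j 1) = (\<Sum>i\<in>UNIV. beta_entry r M i j *\<^sub>R axis i 1)"
    by (simp add: vec_eq_iff mult_lift_nth axis_def if_distrib cong: if_cong)
  ultimately show ?thesis
    by (simp add: U_def vcoeff_tensor_X1 vcoeff_tensor_X2)
qed

text \<open>
  The generator with index \<open>j\<close> is \<open>- (w x\<^sub>1 + M w x\<^sub>2)\<close> for the lift \<open>w\<close> of \<open>e\<^sub>j\<close>, and these \<open>w\<close> form a
  basis of the kernel.
\<close>

lemma tableau_iff:
  assumes D: "DD r M \<noteq> 0"
  shows "P \<in> tableau r M \<longleftrightarrow> homogeneous 1 P \<and> r \<bullet> vcoeff P 1 0 = 0 \<and>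
    r \<bullet> (M *v vcoeff P 1 0) = 0 \<and> vcoeff P 0 1 = M *v vcoeff P 1 0"
  (is "_ \<longleftrightarrow> ?A P")
proof
  have "vpoly.subspace {P. ?A P}"
    by (rule vpoly.subspaceI)
      (force simp: homogeneous_iff inner_add_right matrix_vector_right_distrib
        matrix_vector_mult_scaleR)+
  moreover have "range (U r M) \<subseteq> {P. ?A P}"
    using lift_in_kernel[OF D]
    by (auto simp: homogeneous_iff vcoeff_U linear_neg[OF matrix_vector_mul_linear] split: if_splits)
  ultimately have "tableau r M \<subseteq> {P. ?A P}"
    unfolding tableau_def by (rule vpoly.span_minimal[rotated])
  then show "P \<in> tableau r M \<Longrightarrow> ?A P"
    by blast
next
  assume A: "?A P"
  define v where "v = (\<chi> i. vcoeff P 1 0 $ Inr i)"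
  have w: "vcoeff P 1 0 = lift r M v"
    unfolding v_def using kernel_imp_lift[OF D] A by blast
  have sum_axis: "lift r M v = (\<Sum>j\<in>UNIV. v $ j *\<^sub>R lift r M (axis j 1))"
  proof (subst vec_eq_iff, rule allI)
    fix s show "lift r M v $ s = (\<Sum>j\<in>UNIV. v $ j *\<^sub>R lift r M (axis j 1)) $ s"
    proof (cases s)
      case (Inl t)
      then show ?thesis using exhaust_2[of t] by (auto simp: axis_def if_distrib mult.commute cong: if_cong)
    qed (auto simp: axis_def if_distrib cong: if_cong)
  qed
  have "P = (\<Sum>j\<in>UNIV. vscale (- (v $ j)) (U r M j))"
  proof (rule vpoly_eqI)
    fix a b :: nat
    consider "a = 1" "b = 0" | "a = 0" "b = 1" | "a + b \<noteq> 1"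
      by (auto simp: add_is_1)
    then show "vcoeff P a b = vcoeff (\<Sum>j\<in>UNIV. vscale (- (v $ j)) (U r M j)) a b"
    proof cases
      case 1
      then show ?thesis by (simp add: vcoeff_U w[unfolded One_nat_def] flip: sum_axis)
    next
      case 2
      have "vcoeff P 0 1 = (\<Sum>j\<in>UNIV. v $ j *\<^sub>R (M *v lift r M (axis j 1)))"
        using A w sum_axis
        by (simp add: linear_sum[OF matrix_vector_mul_linear] linear_cmul[OF matrix_vector_mul_linear])
      with 2 show ?thesis by (simp add: vcoeff_U)
    next
      case 3
      then have "vcoeff P a b = 0" and "vcoeff (U r M j) a b = 0" for j
        using A by (auto simp: vcoeff_U homogeneous_iff)
      then show ?thesis by simp
    qed
  qed
  also have "\<dots> \<in> tableau r M"
    unfolding tableau_def by (intro vpoly.span_sum vpoly.span_scale vpoly.span_base) auto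
  finally show "P \<in> tableau r M" .
qed

text \<open>
  A derivative \<open>\<partial>\<^sub>1\<^sup>a \<partial>\<^sub>2\<^sup>b P\<close> with \<open>a + b = q\<close> is a linear form that sees only the two neighbouring
  coefficients of \<open>P\<close> at \<open>x\<^sub>1\<^sup>a\<^sup>+\<^sup>1 x\<^sub>2\<^sup>b\<close> and \<open>x\<^sub>1\<^sup>a x\<^sub>2\<^sup>b\<^sup>+\<^sup>1\<close>. Cancelling the common factor \<open>a! b!\<close>
  turns membership in the tableau into a two-term recursion.
\<close>

lemma prolongation_tableau_iff:
  assumes D: "DD r M \<noteq> 0"
  shows "P \<in> prolongation (tableau r M) q \<longleftrightarrow> homogeneous (q + 1) P \<and>
    (\<forall>a b. a + b = q \<longrightarrow> r \<bullet> vcoeff P (Suc a) b = 0 \<and> r \<bullet> (M *v vcoeff P (Suc a) b) = 0 \<and>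
      real (Suc b) *\<^sub>R vcoeff P a (Suc b) = real (Suc a) *\<^sub>R (M *v vcoeff P (Suc a) b))"
proof (cases "q = 0")
  case True
  then show ?thesis
    by (simp add: prolongation_def tableau_iff[OF D])
next
  case False
  have "(d1 ^^ a) ((d2 ^^ b) P) \<in> tableau r M \<longleftrightarrow>
      r \<bullet> vcoeff P (Suc a) b = 0 \<and> r \<bullet> (M *v vcoeff P (Suc a) b) = 0 \<and>
      real (Suc b) *\<^sub>R vcoeff P a (Suc b) = real (Suc a) *\<^sub>R (M *v vcoeff P (Suc a) b)"
    if hom: "homogeneous (q + 1) P" and ab: "a + b = q" for a b
  proof -
    have poch: "pochhammer 1 k = (fact k :: real)" "pochhammer 2 k = ((1 + real k) * fact k :: real)" for k
      using pochhammer_rec[of "1::real" k] by (simp_all add: pochhammer_fact[symmetric])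
    have "homogeneous 1 ((d1 ^^ a) ((d2 ^^ b) P))"
      using hom ab by (force simp: homogeneous_iff vcoeff_derivatives)
    moreover have "vcoeff ((d1 ^^ a) ((d2 ^^ b) P)) 1 0 = (fact a * fact b) *\<^sub>R (real (Suc a) *\<^sub>R vcoeff P (Suc a) b)"
      "vcoeff ((d1 ^^ a) ((d2 ^^ b) P)) 0 1 = (fact a * fact b) *\<^sub>R (real (Suc b) *\<^sub>R vcoeff P a (Suc b))"
      by (simp_all add: vcoeff_derivatives poch numeral_2_eq_2[symmetric] mult_ac)
    ultimately show ?thesis
      by (simp add: tableau_iff[OF D] matrix_vector_mult_scaleR del: of_nat_Suc scaleR_scaleR)
  qed
  with False show ?thesis
    by (auto simp: prolongation_def)
qed

text \<open>The annihilator of the Krylov space of covectors spanned by \<open>r, r M, \<dots>, r M\<^sup>d\<close>.\<close>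

definition krylov_kernel :: "real^'k \<Rightarrow> real^'k^'k \<Rightarrow> nat \<Rightarrow> (real^'k::finite) set" where
  "krylov_kernel r M d = {w. \<forall>b\<le>d. r \<bullet> ((*v) M ^^ b) w = 0}"

text \<open>
  The recursion determines all coefficients from the leading one and yields
  \<open>a! b! P\<^sub>a\<^sub>,\<^sub>b = M\<^sup>b w\<close>. The conditions \<open>r \<bullet> P\<^sub>a\<^sub>+\<^sub>1\<^sub>,\<^sub>b = 0\<close> give the exponents \<open>0, \<dots>, q\<close>, and
  \<open>r \<bullet> M P\<^sub>1\<^sub>,\<^sub>q = 0\<close> supplies the exponent \<open>q + 1\<close>.
\<close>

lemma prolongation_tableau_eq:
  assumes D: "DD r M \<noteq> 0"
  shows "prolongation (tableau r M) q = solution M (q + 1) ` krylov_kernel r M (q + 1)"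
proof (intro equalityI subsetI)
  fix P assume "P \<in> prolongation (tableau r M) q"
  then have hom: "homogeneous (q + 1) P"
    and ker: "\<And>a b. a + b = q \<Longrightarrow> r \<bullet> vcoeff P (Suc a) b = 0"
      "\<And>a b. a + b = q \<Longrightarrow> r \<bullet> (M *v vcoeff P (Suc a) b) = 0"
    and step: "\<And>a b. a + b = q \<Longrightarrow>
      real (Suc b) *\<^sub>R vcoeff P a (Suc b) = real (Suc a) *\<^sub>R (M *v vcoeff P (Suc a) b)"
    by (auto simp: prolongation_tableau_iff[OF D])
  define w where "w = fact (q + 1) *\<^sub>R vcoeff P (q + 1) 0"
  have pow: "((*v) M ^^ b) w = (fact a * fact b) *\<^sub>R vcoeff P a b" if "a + b = q + 1" for a b
    using that
  proof (induction b arbitrary: a)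
    case 0
    then show ?case by (simp add: w_def)
  next
    case (Suc b)
    then have "((*v) M ^^ Suc b) w = M *v ((fact (Suc a) * fact b) *\<^sub>R vcoeff P (Suc a) b)"
      using Suc.IH[of "Suc a"] by (simp del: fact_Suc)
    also have "\<dots> = (fact a * fact b) *\<^sub>R (real (Suc a) *\<^sub>R (M *v vcoeff P (Suc a) b))"
      by (simp add: matrix_vector_mult_scaleR mult_ac del: of_nat_Suc)
    also have "\<dots> = (fact a * fact (Suc b)) *\<^sub>R vcoeff P a (Suc b)"
      using Suc.prems by (subst step[symmetric]) (simp_all add: mult_ac del: of_nat_Suc)
    finally show ?case .
  qed
  have "P = solution M (q + 1) w"
    using hom by (intro vpoly_eqI) (auto simp: vcoeff_solution pow homogeneous_iff)
  moreover have "r \<bullet> ((*v) M ^^ b) w = 0" if "b \<le> q + 1" for b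
  proof (cases "b \<le> q")
    case True
    then show ?thesis
      using ker(1)[of "q - b" b] pow[of "Suc (q - b)" b] by simp
  next
    case False
    then have "b = Suc q"
      using that by simp
    then show ?thesis
      using ker(2)[of 0 q] pow[of 1 q] by (simp add: matrix_vector_mult_scaleR)
  qed
  ultimately show "P \<in> solution M (q + 1) ` krylov_kernel r M (q + 1)"
    by (auto simp: krylov_kernel_def)
next
  fix P assume "P \<in> solution M (q + 1) ` krylov_kernel r M (q + 1)"
  then obtain w where P: "P = solution M (q + 1) w"
    and w: "\<And>b. b \<le> q + 1 \<Longrightarrow> r \<bullet> ((*v) M ^^ b) w = 0"
    by (auto simp: krylov_kernel_def)
  have "r \<bullet> (M *v ((*v) M ^^ b) w) = 0" if "b \<le> q" for b
    using w[of "Suc b"] that by simp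
  with w show "P \<in> prolongation (tableau r M) q"
    unfolding P by (auto simp: prolongation_tableau_iff[OF D] homogeneous_iff vcoeff_solution
        matrix_vector_mult_scaleR divide_simps)
qed

text \<open>
  The vector \<open>w\<close> that determines an element is the coefficient of a pure power of \<open>x\<^sub>1\<close>, up to a
  nonzero factor, so \<open>\<partial>\<^sub>1\<close> can annihilate the element only if \<open>w = 0\<close>.
\<close>

lemma prolongation1_tableau_trivial:
  assumes D: "DD r M \<noteq> 0"
  shows "prolongation1 (tableau r M) q \<subseteq> {0}"
proof
  fix P assume P: "P \<in> prolongation1 (tableau r M) q"
  then obtain w where w: "P = solution M (q + 1) w" and "d1 P = 0"
    by (auto simp: prolongation1_def prolongation_tableau_eq[OF D])
  then have "vcoeff ((d1 ^^ 1) P) q 0 = 0"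
    by simp
  then have "w = 0"
    by (simp only: vcoeff_d1_pow) (simp add: w vcoeff_solution)
  moreover have "solution M (q + 1) 0 = 0"
    by (rule vpoly_eqI) (simp add: vcoeff_solution linear_0[OF linear_mult_pow])
  ultimately show "P \<in> {0}"
    using w by simp
qed

lemma involutive_tableau_iff:
  assumes D: "DD r M \<noteq> 0"
  shows "involutive_prolongation (tableau r M) q \<longleftrightarrow>
    dim (krylov_kernel r M (q + 2)) = dim (krylov_kernel r M (q + 1))"
proof -
  have "vpoly.dim (prolongation1 (tableau r M) q) \<le> card ({} :: (2 + 'a) vpoly set)"
    using prolongation1_tableau_trivial[OF D, of q] by (intro vpoly.dim_le_card) auto
  then show ?thesis
    by (simp add: involutive_prolongation_def prolongation_tableau_eq[OF D] dim_image_solution)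
qed

section \<open>The Krylov space in the chart\<close>

lemma mat_power_mult: "mat_power B k *v v = ((*v) B ^^ k) v"
proof (induction k arbitrary: v)
  case (Suc k)
  then show ?case
    by (simp add: mat_power_def funpow_swap1 flip: matrix_vector_mul_assoc)
qed (simp add: mat_power_def)

text \<open>
  By definition \<open>\<beta> v\<close> consists of the last coordinates of \<open>M\<close> times the lift of \<open>v\<close>. Lifting them
  again recovers that vector when it lies in the kernel of \<open>r\<close> and \<open>r M\<close>. For \<open>M\<^sup>b w\<close> this
  involves the exponents \<open>b\<close> and \<open>b + 1\<close>, hence the shift by one in the hypothesis on \<open>w\<close>.
\<close>

lemma lift_beta_pow:
  assumes D: "DD r M \<noteq> 0" and w: "w \<in> krylov_kernel r M (Suc d)" and "b \<le> d"
  shows "((*v) M ^^ b) w = lift r M (((*v) (beta r M) ^^ b) (\<chi> i. w $ Inr i))"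
  using \<open>b \<le> d\<close>
proof (induction b)
  have "r \<bullet> ((*v) M ^^ k) w = 0" if "k \<le> Suc d" for k
    using w that by (simp add: krylov_kernel_def)
  then have ker: "r \<bullet> ((*v) M ^^ b) w = 0" "r \<bullet> (M *v ((*v) M ^^ b) w) = 0" if "b \<le> d" for b
    using that by (metis le_SucI, metis Suc_le_mono comp_apply funpow.simps(2))
  {
    case 0
    then show ?case
      using kernel_imp_lift[OF D, of w] ker[of 0] by simp
  next
    case (Suc b)
    define v where "v = ((*v) (beta r M) ^^ b) (\<chi> i. w $ Inr i)"
    have "((*v) M ^^ Suc b) w = M *v lift r M v"
      using Suc by (simp add: v_def)
    moreover have "(\<chi> i. (M *v lift r M v) $ Inr i) = beta r M *v v"
      by (simp add: vec_eq_iff mult_lift_nth) (simp add: beta_def matrix_vector_mult_def)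
    ultimately show ?case
      using kernel_imp_lift[OF D ker[OF Suc.prems]] by (simp add: v_def)
  }
qed

lemma inner_D0_beta_power:
  assumes D: "DD r M \<noteq> 0" and w: "w \<in> krylov_kernel r M (Suc d)" and "k \<le> d"
  shows "(D0 r M v* mat_power (beta r M) k) \<bullet> (\<chi> i. w $ Inr i) =
    (r \<bullet> ((*v) M ^^ (k + 2)) w) / DD r M"
  using lift_beta_pow[OF assms]
  by (simp add: dot_lmul_matrix mat_power_mult D0_inner[OF D])

lemma krylov_kernel_stable:
  assumes D: "DD r M \<noteq> 0"
    and dep: "D0 r M v* mat_power (beta r M) d
      \<in> span ((\<lambda>k. D0 r M v* mat_power (beta r M) k) ` {..<d})"
  shows "krylov_kernel r M (d + 2) = krylov_kernel r M (d + 1)"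
proof
  show "krylov_kernel r M (d + 2) \<subseteq> krylov_kernel r M (d + 1)"
    by (auto simp: krylov_kernel_def)
  show "krylov_kernel r M (d + 1) \<subseteq> krylov_kernel r M (d + 2)"
  proof
    fix w assume "w \<in> krylov_kernel r M (d + 1)"
    then have w: "w \<in> krylov_kernel r M (Suc d)"
      by simp
    define v where "v = (\<chi> i. w $ Inr i)"
    have "orthogonal v x" if x: "x \<in> (\<lambda>k. D0 r M v* mat_power (beta r M) k) ` {..<d}" for x
    proof -
      obtain k where k: "k < d" "x = D0 r M v* mat_power (beta r M) k"
        using x by auto
      then have "r \<bullet> ((*v) M ^^ (k + 2)) w = 0"
        using w by (simp add: krylov_kernel_def del: funpow.simps)
      then have "x \<bullet> v = 0"
        using inner_D0_beta_power[OF D w, of k] k by (simp add: v_def)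
      then show ?thesis
        by (simp add: orthogonal_def inner_commute)
    qed
    then have "orthogonal v (D0 r M v* mat_power (beta r M) d)"
      using orthogonal_to_span dep by blast
    then have "r \<bullet> ((*v) M ^^ (d + 2)) w = 0"
      using inner_D0_beta_power[OF D w, of d] D
      by (simp add: v_def orthogonal_def inner_commute)
    with w show "w \<in> krylov_kernel r M (d + 2)"
      by (auto simp: krylov_kernel_def le_Suc_eq)
  qed
qed

theorem theorem3p2:
  fixes n q :: nat
    and \<Omega> :: "(real^(2 + 'm::finite)) set"
    and \<rho> :: "real^(2 + 'm) \<Rightarrow> real"
    and \<A> :: "real^(2 + 'm) \<Rightarrow> real^(2 + 'm)^(2 + 'm)"
    and p :: "real^(2 + 'm)"
  assumes "n \<ge> 2" and "CARD(2 + 'm) = 2 * n"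
    and "open \<Omega>"
    and "real_analytic_on \<rho> \<Omega>"
    and "\<And>j i. real_analytic_on (\<lambda>y. \<A> y $ j $ i) \<Omega>"
    and "p \<in> \<Omega>"
    and "DD (gradient \<rho> p) (\<A> p) \<noteq> 0"
    and "q \<ge> 1"
    and "D0 (gradient \<rho> p) (\<A> p) v* mat_power (beta (gradient \<rho> p) (\<A> p)) (q - 1)
         \<in> span ((\<lambda>k. D0 (gradient \<rho> p) (\<A> p) v* mat_power (beta (gradient \<rho> p) (\<A> p)) k) ` {..<q - 1})"
  shows "involutive_prolongation (tableau (gradient \<rho> p) (\<A> p)) (q - 1)"
  using involutive_tableau_iff krylov_kernel_stable assms(7,9) by metis

end
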